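(* Let $G$ be a finitely generated group. Then for every integer $n\geq 0$ the following are equivalent: (i) $\gamma_{n+1}(G)$ is a finitely generated group; (ii) $\gamma_{n+1}(H)$ is a finitely generated group for every extension of groups $1\to N\to H\to G\to 1$ (short exact sequence, $N$ being identified with its image in $H$) with $N\leq Z_n(H)$.
   Context: For a group $H$, $\gamma_n(H)$ is the $n$-th term of the lower central series, with $\gamma_1(H)=H$ and $\gamma_{n+1}(H)=[\gamma_n(H),H]$, and $Z_n(H)$ is the $n$-th term of the upper central series, with $Z_0(H)=1$ and $Z_1(H)=Z(H)$ the centre. *)

theory Defs
  imports "HOL-Algebra.Algebra"
begin

definition finitely_generated :: "('a, 'm) monoid_scheme \<Rightarrow> bool" where
  "finitely_generated G \<longleftrightarrow>
     (\<exists>S. finite S \<and> S \<subseteq> carrier G \<and> generate G S = carrier G)"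

text \<open>The subgroup $[A,B]$ generated by the commutators $a b a^{-1} b^{-1}$, the form also used
  by \<^const>\<open>derived\<close>.\<close>

definition commutator_subgroup ::
    "('a, 'm) monoid_scheme \<Rightarrow> 'a set \<Rightarrow> 'a set \<Rightarrow> 'a set" where
  "commutator_subgroup G A B =
     generate G (\<Union>a\<in>A. \<Union>b\<in>B. {a \<otimes>\<^bsub>G\<^esub> b \<otimes>\<^bsub>G\<^esub> inv\<^bsub>G\<^esub> a \<otimes>\<^bsub>G\<^esub> inv\<^bsub>G\<^esub> b})"

text \<open>The index is the usual one, starting at $\gamma_1(G) = G$. The value at \<open>0\<close> is only there
  to make the function total.\<close>

fun lower_central :: "('a, 'm) monoid_scheme \<Rightarrow> nat \<Rightarrow> 'a set" where
  "lower_central G 0 = carrier G"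
| "lower_central G (Suc 0) = carrier G"
| "lower_central G (Suc (Suc n)) =
     commutator_subgroup G (lower_central G (Suc n)) (carrier G)"

definition group_center :: "('a, 'm) monoid_scheme \<Rightarrow> 'a set" where
  "group_center G = {z \<in> carrier G. \<forall>x\<in>carrier G. z \<otimes>\<^bsub>G\<^esub> x = x \<otimes>\<^bsub>G\<^esub> z}"

text \<open>$Z_{n+1}(G)$ is the preimage of the centre of $G/Z_n(G)$ under the quotient map.\<close>

fun upper_central :: "('a, 'm) monoid_scheme \<Rightarrow> nat \<Rightarrow> 'a set" where
  "upper_central G 0 = {\<one>\<^bsub>G\<^esub>}"
| "upper_central G (Suc n) =
     {x \<in> carrier G. upper_central G n #>\<^bsub>G\<^esub> x \<in> group_center (G Mod upper_central G n)}"

text \<open>The short exact sequence $1 \to N \to H \to G \to 1$ whose first map is the inclusion of a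
  subgroup $N$ of $H$ and whose second map is \<open>\<pi>\<close>.\<close>

definition group_extension ::
    "'h set \<Rightarrow> ('h, 'k) monoid_scheme \<Rightarrow> ('a, 'm) monoid_scheme \<Rightarrow> ('h \<Rightarrow> 'a) \<Rightarrow> bool" where
  "group_extension N H G \<pi> \<longleftrightarrow>
     group H \<and> group G \<and> subgroup N H \<and> \<pi> \<in> epi H G \<and> kernel H G \<pi> = N"

text \<open>A formula of HOL cannot quantify over types, so "every extension $H$ of $G$" has to be
  relative to one carrier type. For a group \<open>G\<close> with carrier type \<open>'a\<close> we use \<open>'a + 'b\<close> with
  \<open>'b\<close> an arbitrary type: it contains a copy of every group with carrier type \<open>'b\<close>, so no
  extension is lost, whatever its cardinality, and it contains a copy of \<open>G\<close> itself, so the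
  condition is not vacuous for a small \<open>'b\<close>.\<close>

end

theory Submission
  imports Defs
begin

text \<open>For (i) to (ii), let \<open>T\<close> be a finite inverse-closed set of lifts to \<open>H\<close> of generators of \<open>G\<close>,
  and let the finite set \<open>A\<close> in $\gamma_{n+1}(H)$ contain lifts of generators of $\gamma_{n+1}(G)$ and all
  left-normed commutators of weight $n+1$ in \<open>T\<close>. Each conjugate of $a \in A$ by $t \in T$ is an
  element of $\langle A \rangle$ times some $z(a,t) \in N \cap \gamma_{n+1}(H)$. As $N \leq Z_n(H)$, the
  commutators $[z(a,t), t_1, \dots, t_j]$ vanish for $j \geq n$, so adding all of them to \<open>A\<close> keeps it
  finite and makes the generated subgroup \<open>K\<close> invariant under \<open>T\<close>; it is invariant under \<open>N\<close> because
  $[\gamma_{n+1}(H), Z_n(H)] = 1$. Hence \<open>K\<close> is normal in $H = \langle T \rangle N$, and $H/K$ is nilpotent of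
  class at most \<open>n\<close>, so $K = \gamma_{n+1}(H)$.\<close>

section \<open>Commutators and the upper central series relative to a subgroup\<close>

definition commutator :: "('a, 'm) monoid_scheme \<Rightarrow> 'a \<Rightarrow> 'a \<Rightarrow> 'a" where
  "commutator G x y = x \<otimes>\<^bsub>G\<^esub> y \<otimes>\<^bsub>G\<^esub> inv\<^bsub>G\<^esub> x \<otimes>\<^bsub>G\<^esub> inv\<^bsub>G\<^esub> y"

text \<open>For normal \<open>M\<close> this is the preimage in \<open>G\<close> of the centre of
  \<open>G Mod M\<close>. The commutator form stays inside \<open>G\<close>, so iterating it needs
  no nested quotients and different \<open>M\<close> can be compared.\<close>

definition center_mod :: "('a, 'm) monoid_scheme \<Rightarrow> 'a set \<Rightarrow> 'a set" where
  "center_mod G M = {x \<in> carrier G. \<forall>y\<in>carrier G. commutator G x y \<in> M}"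

fun upper_central_mod :: "('a, 'm) monoid_scheme \<Rightarrow> 'a set \<Rightarrow> nat \<Rightarrow> 'a set" where
  "upper_central_mod G M 0 = M"
| "upper_central_mod G M (Suc n) = center_mod G (upper_central_mod G M n)"

text \<open>Iterated commutators [a, t_1, ..., t_n]. The index counts the entries from
  \<open>T\<close>, so for \<open>A = T\<close> the weight is n+1.\<close>

fun left_normed :: "('a, 'm) monoid_scheme \<Rightarrow> 'a set \<Rightarrow> 'a set \<Rightarrow> nat \<Rightarrow> 'a set" where
  "left_normed G A T 0 = A"
| "left_normed G A T (Suc n) = (\<Union>x\<in>left_normed G A T n. commutator G x ` T)"

lemma finite_left_normed:
  "finite A \<Longrightarrow> finite T \<Longrightarrow> finite (left_normed G A T n)"
  by (induction n) auto

lemma lower_central_Suc_Suc: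
  "lower_central G (Suc (Suc n)) =
     generate G (\<Union>x\<in>lower_central G (Suc n). commutator G x ` carrier G)"
proof -
  have "(\<Union>a\<in>A. \<Union>b\<in>B. {commutator G a b}) = (\<Union>a\<in>A. commutator G a ` B)" for A B
    by auto
  then show ?thesis
    by (simp add: commutator_subgroup_def commutator_def)
qed

section \<open>Commutator and conjugation identities\<close>

context group
begin

lemma inv_cancel_left:
  "x \<in> carrier G \<Longrightarrow> y \<in> carrier G \<Longrightarrow> inv x \<otimes> (x \<otimes> y) = y"
  "x \<in> carrier G \<Longrightarrow> y \<in> carrier G \<Longrightarrow> x \<otimes> (inv x \<otimes> y) = y"
  by (simp_all add: m_assoc[symmetric])

lemma commutator_closed [simp]:
  "x \<in> carrier G \<Longrightarrow> y \<in> carrier G \<Longrightarrow> commutator G x y \<in> carrier G"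
  by (simp add: commutator_def)

lemma commutator_eq_one_iff:
  assumes "x \<in> carrier G" "y \<in> carrier G"
  shows "commutator G x y = \<one> \<longleftrightarrow> x \<otimes> y = y \<otimes> x"
proof
  assume "x \<otimes> y = y \<otimes> x"
  then show "commutator G x y = \<one>"
    using assms by (simp add: commutator_def m_assoc inv_cancel_left)
next
  have "x \<otimes> y = commutator G x y \<otimes> (y \<otimes> x)"
    using assms by (simp add: commutator_def m_assoc inv_cancel_left)
  moreover assume "commutator G x y = \<one>"
  ultimately show "x \<otimes> y = y \<otimes> x"
    using assms by simp
qed

lemma commute_inv:
  assumes "x \<in> carrier G" "y \<in> carrier G" "x \<otimes> y = y \<otimes> x"
  shows "inv x \<otimes> y = y \<otimes> inv x"
proof -
  have "inv x \<otimes> y = inv x \<otimes> (y \<otimes> x) \<otimes> inv x"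
    using assms(1,2) by (simp add: m_assoc)
  also have "\<dots> = inv x \<otimes> (x \<otimes> y) \<otimes> inv x"
    by (simp only: assms(3))
  finally show ?thesis
    using assms(1,2) by (simp add: inv_cancel_left)
qed

lemma commute_mult:
  assumes "x \<in> carrier G" "y \<in> carrier G" "z \<in> carrier G" "x \<otimes> z = z \<otimes> x" "y \<otimes> z = z \<otimes> y"
  shows "(x \<otimes> y) \<otimes> z = z \<otimes> (x \<otimes> y)"
  using assms by (metis m_assoc)

lemma conj_mult:
  assumes "z \<in> carrier G" "x \<in> carrier G" "y \<in> carrier G"
  shows "z \<otimes> (x \<otimes> y) \<otimes> inv z = (z \<otimes> x \<otimes> inv z) \<otimes> (z \<otimes> y \<otimes> inv z)"
  using assms by (simp add: m_assoc inv_cancel_left)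

lemma conj_inv:
  assumes "z \<in> carrier G" "x \<in> carrier G"
  shows "z \<otimes> inv x \<otimes> inv z = inv (z \<otimes> x \<otimes> inv z)"
  using assms by (simp add: m_assoc inv_mult_group)

lemma conj_commutator:
  assumes "z \<in> carrier G" "x \<in> carrier G" "y \<in> carrier G"
  shows "z \<otimes> commutator G x y \<otimes> inv z =
    commutator G (z \<otimes> x \<otimes> inv z) (z \<otimes> y \<otimes> inv z)"
  using assms by (simp add: commutator_def m_assoc inv_mult_group inv_cancel_left)

text \<open>Write z x z^{-1} = x c and z y z^{-1} = y e with c = [x^{-1}, z] and e = [y^{-1}, z];
  hence the inverses in the hypotheses. In [x c, y e] the central c cancels, and e cancels after
  moving past x^{-1}, so conjugation by z fixes [x, y].\<close>

lemma commutator_commute: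
  assumes carr: "x \<in> carrier G" "y \<in> carrier G" "z \<in> carrier G"
    and central: "\<And>g. g \<in> carrier G \<Longrightarrow> commutator G (inv x) z \<otimes> g = g \<otimes> commutator G (inv x) z"
    and comm: "commutator G (inv y) z \<otimes> x = x \<otimes> commutator G (inv y) z"
  shows "z \<otimes> commutator G x y = commutator G x y \<otimes> z"
proof -
  define c e where "c = commutator G (inv x) z" and "e = commutator G (inv y) z"
  have ce: "c \<in> carrier G" "e \<in> carrier G"
    using carr by (simp_all add: c_def e_def)
  have x: "z \<otimes> x \<otimes> inv z = x \<otimes> c" and y: "z \<otimes> y \<otimes> inv z = y \<otimes> e"
    using carr by (simp_all add: c_def e_def commutator_def m_assoc inv_cancel_left)
  have c: "c \<otimes> g = g \<otimes> c" if "g \<in> carrier G" for g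
    using central that by (simp add: c_def)
  have e: "inv e \<otimes> inv x = inv x \<otimes> inv e"
    using comm carr ce by (metis e_def inv_mult_group)
  have "z \<otimes> commutator G x y \<otimes> inv z = commutator G (x \<otimes> c) (y \<otimes> e)"
    using carr by (simp add: conj_commutator x y)
  also have "\<dots> = x \<otimes> (c \<otimes> (y \<otimes> e)) \<otimes> inv c \<otimes> inv x \<otimes> inv e \<otimes> inv y"
    using carr ce by (simp add: commutator_def m_assoc inv_mult_group)
  also have "\<dots> = x \<otimes> (y \<otimes> e) \<otimes> (inv x \<otimes> inv e) \<otimes> inv y"
    using carr ce c[of "y \<otimes> e"] by (simp add: m_assoc inv_cancel_left)
  also have "\<dots> = x \<otimes> (y \<otimes> e) \<otimes> (inv e \<otimes> inv x) \<otimes> inv y"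
    by (simp only: e)
  also have "\<dots> = commutator G x y"
    using carr ce by (simp add: commutator_def m_assoc inv_cancel_left)
  finally have "z \<otimes> commutator G x y \<otimes> inv z \<otimes> z = commutator G x y \<otimes> z"
    by simp
  then show ?thesis
    using carr by (simp add: m_assoc)
qed

lemma group_center_normal: "group_center G \<lhd> G"
proof (rule normal_invI)
  show "subgroup (group_center G) G"
  proof (rule subgroupI)
    show "group_center G \<noteq> {}"
      by (auto simp: group_center_def intro!: exI[of _ \<one>])
    show "inv x \<in> group_center G" if "x \<in> group_center G" for x
      using that unfolding group_center_def by (blast intro: commute_inv)
    show "x \<otimes> y \<in> group_center G" if "x \<in> group_center G" "y \<in> group_center G" for x y
      using that unfolding group_center_def by (blast intro: commute_mult)
  qed (auto simp: group_center_def)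
next
  fix x h assume "x \<in> carrier G" "h \<in> group_center G"
  moreover from this have "h \<otimes> x = x \<otimes> h" "h \<in> carrier G"
    by (simp_all add: group_center_def)
  then have "x \<otimes> h \<otimes> inv x = h"
    using \<open>x \<in> carrier G\<close> by (metis inv_closed m_assoc r_inv r_one)
  ultimately show "x \<otimes> h \<otimes> inv x \<in> group_center G"
    by simp
qed

lemma upper_central_mod_mono:
  "M \<subseteq> M' \<Longrightarrow> upper_central_mod G M n \<subseteq> upper_central_mod G M' n"
  by (induction n) (auto simp: center_mod_def)

end

section \<open>Centre and centralizers modulo a normal subgroup\<close>

context normal
begin

lemma group_hom_Mod: "group_hom G (G Mod H) ((#>) H)"
  by (simp add: group_hom_def group_hom_axioms_def factorgroup_is_group r_coset_hom_Mod)

lemma rcos_eq_iff: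
  assumes "x \<in> carrier G"
  shows "H #> x = H \<longleftrightarrow> x \<in> H"
  using assms coset_join1 coset_join2 subgroup_axioms by blast

lemma carrier_Mod: "carrier (G Mod H) = (#>) H ` carrier G"
  by (auto simp: FactGroup_def RCOSETS_def)

lemma rcos_commutator:
  assumes "x \<in> carrier G" "y \<in> carrier G"
  shows "H #> commutator G x y = commutator (G Mod H) (H #> x) (H #> y)"
proof -
  interpret q: group_hom G "G Mod H" "(#>) H" by (rule group_hom_Mod)
  show ?thesis using assms by (simp add: commutator_def del: mult_FactGroup)
qed

text \<open>This reduces statements modulo \<open>H\<close> to plain commutation in the quotient,
  where the elementary lemmas on commuting elements apply.\<close>

lemma commutator_in_iff:
  assumes "x \<in> carrier G" "y \<in> carrier G"
  shows "commutator G x y \<in> H \<longleftrightarrow>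
    (H #> x) \<otimes>\<^bsub>G Mod H\<^esub> (H #> y) = (H #> y) \<otimes>\<^bsub>G Mod H\<^esub> (H #> x)"
proof -
  interpret q: group_hom G "G Mod H" "(#>) H" by (rule group_hom_Mod)
  have "commutator G x y \<in> H \<longleftrightarrow> H #> commutator G x y = \<one>\<^bsub>G Mod H\<^esub>"
    using assms by (simp add: rcos_eq_iff)
  also have "\<dots> \<longleftrightarrow> commutator (G Mod H) (H #> x) (H #> y) = \<one>\<^bsub>G Mod H\<^esub>"
    using assms by (simp add: rcos_commutator)
  also have "\<dots> \<longleftrightarrow> (H #> x) \<otimes>\<^bsub>G Mod H\<^esub> (H #> y) = (H #> y) \<otimes>\<^bsub>G Mod H\<^esub> (H #> x)"
    using assms by (intro q.H.commutator_eq_one_iff) auto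
  finally show ?thesis .
qed

lemma commutator_in_sym:
  assumes "x \<in> carrier G" "y \<in> carrier G"
  shows "commutator G x y \<in> H \<longleftrightarrow> commutator G y x \<in> H"
  using assms by (auto simp only: commutator_in_iff)

lemma center_mod_eq: "center_mod G H = {x \<in> carrier G. H #> x \<in> group_center (G Mod H)}"
  by (auto simp: center_mod_def group_center_def carrier_Mod commutator_in_iff simp del: mult_FactGroup)

lemma center_mod_normal: "center_mod G H \<lhd> G"
proof -
  interpret q: group_hom G "G Mod H" "(#>) H" by (rule group_hom_Mod)
  interpret Z: normal "group_center (G Mod H)" "G Mod H" by (rule q.H.group_center_normal)
  show ?thesis
  proof (rule normal_invI)
    have "\<one> \<in> center_mod G H"
      using Z.one_closed by (simp add: center_mod_eq)
    then show "subgroup (center_mod G H) G"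
      by (intro subgroupI) (auto simp: center_mod_eq simp del: mult_FactGroup)
    show "x \<otimes> h \<otimes> inv x \<in> center_mod G H" if "x \<in> carrier G" "h \<in> center_mod G H" for x h
      using that Z.inv_op_closed2 by (simp add: center_mod_eq del: mult_FactGroup)
  qed
qed

lemma commutator_in:
  assumes "x \<in> H" "y \<in> carrier G"
  shows "commutator G x y \<in> H"
proof -
  have "y \<otimes> inv x \<otimes> inv y \<in> H"
    using assms inv_op_closed2 by simp
  moreover have "commutator G x y = x \<otimes> (y \<otimes> inv x \<otimes> inv y)"
    using assms by (simp add: commutator_def m_assoc)
  ultimately show ?thesis
    using assms by simp
qed

lemma commutator_in_right: "x \<in> carrier G \<Longrightarrow> y \<in> H \<Longrightarrow> commutator G x y \<in> H"
  using commutator_in commutator_in_sym subset by blast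

lemma subset_center_mod: "H \<subseteq> center_mod G H"
  by (auto simp: center_mod_def commutator_in)

lemma upper_central_mod_normal: "upper_central_mod G H n \<lhd> G"
  by (induction n) (simp_all add: normal_axioms normal.center_mod_normal)

text \<open>The set is the preimage of the centralizer of \<open>H #> x\<close> in the quotient.
  Being a subgroup, it can be tested on generators, as \<open>commutator_generate\<close>
  does.\<close>

lemma centralizer_mod_subgroup:
  assumes "x \<in> carrier G"
  shows "subgroup {y \<in> carrier G. commutator G x y \<in> H} G"
proof -
  interpret q: group_hom G "G Mod H" "(#>) H" by (rule group_hom_Mod)
  \<comment> \<open>The flip puts the varying element first, as in \<open>commute_inv\<close> and
    \<open>commute_mult\<close>.\<close>
  have "{y \<in> carrier G. commutator G x y \<in> H} = {y \<in> carrier G. commutator G y x \<in> H}"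
    using assms commutator_in_sym by auto
  also have "subgroup \<dots> G"
  proof (rule subgroupI)
    show "{y \<in> carrier G. commutator G y x \<in> H} \<noteq> {}"
      using assms commutator_in[OF subgroup.one_closed[OF subgroup_axioms]] subset by blast
    show "inv y \<in> {y \<in> carrier G. commutator G y x \<in> H}"
      if "y \<in> {y \<in> carrier G. commutator G y x \<in> H}" for y
    proof -
      have y: "y \<in> carrier G" "commutator G y x \<in> H"
        using that by auto
      then have "(H #> y) \<otimes>\<^bsub>G Mod H\<^esub> (H #> x) = (H #> x) \<otimes>\<^bsub>G Mod H\<^esub> (H #> y)"
        using assms commutator_in_iff by blast
      then show ?thesis
        using y assms q.H.commute_inv[of "H #> y" "H #> x"]
        by (simp add: commutator_in_iff del: mult_FactGroup)
    qed
    show "y \<otimes> z \<in> {y \<in> carrier G. commutator G y x \<in> H}"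
      if "y \<in> {y \<in> carrier G. commutator G y x \<in> H}" "z \<in> {y \<in> carrier G. commutator G y x \<in> H}"
      for y z
    proof -
      have yz: "y \<in> carrier G" "commutator G y x \<in> H" "z \<in> carrier G" "commutator G z x \<in> H"
        using that by auto
      then have "(H #> y) \<otimes>\<^bsub>G Mod H\<^esub> (H #> x) = (H #> x) \<otimes>\<^bsub>G Mod H\<^esub> (H #> y)"
        "(H #> z) \<otimes>\<^bsub>G Mod H\<^esub> (H #> x) = (H #> x) \<otimes>\<^bsub>G Mod H\<^esub> (H #> z)"
        using assms commutator_in_iff by blast+
      then show ?thesis
        using yz assms q.H.commute_mult[of "H #> y" "H #> z" "H #> x"]
        by (simp add: commutator_in_iff del: mult_FactGroup)
    qed
  qed auto
  finally show ?thesis .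
qed

lemma commutator_generate:
  assumes "x \<in> carrier G" "T \<subseteq> carrier G" "\<And>t. t \<in> T \<Longrightarrow> commutator G x t \<in> H"
    "y \<in> generate G T"
  shows "commutator G x y \<in> H"
  using generate_subgroup_incl[OF _ centralizer_mod_subgroup[OF assms(1)], of T] assms by blast

end

section \<open>The lower central series against the upper central series\<close>

lemma (in group) upper_central_eq: "upper_central G n = upper_central_mod G {\<one>} n"
proof (induction n)
  case (Suc n)
  then show ?case
    by (simp add: normal.center_mod_eq[OF normal.upper_central_mod_normal[OF one_is_normal]])
qed simp

text \<open>A conjugate of [x, y] is the commutator of the conjugates, so the generating set of each
  term is itself invariant under conjugation.\<close>

lemma (in group) lower_central_normal: "lower_central G n \<lhd> G"
proof (induction n)
  case 0
  show ?case
    by (simp add: normal_invI subgroup_self)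
next
  case (Suc n)
  show ?case
  proof (cases n)
    case 0
    then show ?thesis
      by (simp add: normal_invI subgroup_self)
  next
    case n: (Suc m)
    interpret L: normal "lower_central G (Suc m)" G
      using Suc n by simp
    show ?thesis
      unfolding n lower_central_Suc_Suc
    proof (rule normal_generateI)
      fix h g
      assume "h \<in> (\<Union>x\<in>lower_central G (Suc m). commutator G x ` carrier G)"
        and g: "g \<in> carrier G"
      then obtain x y where xy: "x \<in> lower_central G (Suc m)" "y \<in> carrier G" "h = commutator G x y"
        by auto
      then show "g \<otimes> h \<otimes> inv g \<in> (\<Union>x\<in>lower_central G (Suc m). commutator G x ` carrier G)"
        using g L.inv_op_closed2
        by (auto simp: conj_commutator intro!: bexI[of _ "g \<otimes> x \<otimes> inv g"])
    qed (use L.subset in auto)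
  qed
qed

lemma (in group) lower_central_subset_carrier: "lower_central G n \<subseteq> carrier G"
  using lower_central_normal[of n] normal_imp_subgroup subgroup.subset by blast

lemma (in group) commutator_in_lower_central:
  assumes "x \<in> lower_central G (Suc n)" "y \<in> carrier G"
  shows "commutator G x y \<in> lower_central G (Suc (Suc n))"
  unfolding lower_central_Suc_Suc using assms by (intro generate.incl) auto

lemma (in group) left_normed_subset_lower_central:
  assumes "T \<subseteq> carrier G"
  shows "left_normed G T T n \<subseteq> lower_central G (Suc n)"
proof (induction n)
  case (Suc n)
  then show ?case
    using assms commutator_in_lower_central[of _ n] unfolding left_normed.simps by blast
qed (use assms in simp)

text \<open>The step conjugates $[a,b]$ by \<open>z\<close> modulo the target subgroup: \<open>a\<close> is multiplied by an
  element that is central there and \<open>b\<close> by one that commutes with \<open>a\<close>, so $[a,b]$ does not change.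
  Truncated subtraction is harmless, as the lower central series decreases.\<close>

lemma (in normal) commutator_lower_upper_central:
  "x \<in> lower_central G (Suc i) \<Longrightarrow> z \<in> upper_central_mod G H j \<Longrightarrow>
    commutator G x z \<in> upper_central_mod G H (j - Suc i)"
proof (induction i arbitrary: x z j)
  case 0
  show ?case
  proof (cases j)
    case 0
    then show ?thesis
      using "0.prems" commutator_in_right by simp
  next
    case (Suc j')
    interpret M: normal "upper_central_mod G H j'" G by (rule upper_central_mod_normal)
    show ?thesis
      using "0.prems" Suc M.commutator_in_sym by (auto simp: center_mod_def)
  qed
next
  case (Suc i)
  have x: "x \<in> carrier G"
    using Suc.prems(1) lower_central_subset_carrier by blast
  show ?case
  proof (cases j)
    case 0
    then show ?thesis
      using Suc.prems(2) x commutator_in_right by simp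
  next
    case j: (Suc j')
    define M where "M = upper_central_mod G H (j' - Suc i)"
    interpret M: normal M G
      unfolding M_def by (rule upper_central_mod_normal)
    interpret q: group_hom G "G Mod M" "(#>) M"
      by (rule M.group_hom_Mod)
    \<comment> \<open>The induction hypothesis puts [a^{-1}, z] one level above \<open>M\<close>,
      that is, into the centre modulo \<open>M\<close>. If the subtraction truncates, both levels
      are 0 and \<open>subset_center_mod\<close> applies.\<close>
    have M: "upper_central_mod G H (Suc j' - Suc i) \<subseteq> center_mod G M"
    proof (cases "i < j'")
      case True
      then have "Suc j' - Suc i = Suc (j' - Suc i)"
        by simp
      then show ?thesis
        by (simp add: M_def)
    next
      case False
      then show ?thesis
        using subset_center_mod by (simp add: M_def)
    qed
    have z: "z \<in> carrier G"
      using Suc.prems(2) j by (simp add: center_mod_def)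
    \<comment> \<open>The elements commuting with \<open>z\<close> modulo \<open>M\<close> form a
      subgroup, so it suffices to treat the generators [a, b] of the term containing
      \<open>x\<close>.\<close>
    have "commutator G z t \<in> M"
      if t: "t \<in> (\<Union>a\<in>lower_central G (Suc i). commutator G a ` carrier G)" for t
    proof -
      obtain a b where ab: "a \<in> lower_central G (Suc i)" "b \<in> carrier G" "t = commutator G a b"
        using t by auto
      interpret L: normal "lower_central G (Suc i)" G
        by (rule lower_central_normal)
      interpret U: normal "upper_central_mod G H j'" G
        by (rule upper_central_mod_normal)
      have a: "a \<in> carrier G" "inv a \<in> lower_central G (Suc i)"
        using ab L.subset by auto
      have "commutator G (inv a) z \<in> center_mod G M"
        using Suc.IH[OF a(2) Suc.prems(2)] M j by auto
      then have c: "(M #> commutator G (inv a) z) \<otimes>\<^bsub>G Mod M\<^esub> (M #> g) =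
          (M #> g) \<otimes>\<^bsub>G Mod M\<^esub> (M #> commutator G (inv a) z)" if "g \<in> carrier G" for g
        using that M.commutator_in_iff[of "commutator G (inv a) z" g]
        by (simp add: center_mod_def del: mult_FactGroup)
      \<comment> \<open>One level is lost here because \<open>z\<close> is central modulo level
        \<open>j'\<close>; the induction hypothesis for \<open>a\<close> then leads down to
        \<open>M\<close>.\<close>
      have "commutator G (inv b) z \<in> upper_central_mod G H j'"
        using Suc.prems(2) j ab z U.commutator_in_sym[of "inv b" z] by (simp add: center_mod_def)
      then have "commutator G a (commutator G (inv b) z) \<in> M"
        using Suc.IH[OF ab(1)] by (simp add: M_def)
      then have e: "(M #> commutator G (inv b) z) \<otimes>\<^bsub>G Mod M\<^esub> (M #> a) =
          (M #> a) \<otimes>\<^bsub>G Mod M\<^esub> (M #> commutator G (inv b) z)"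
        using a ab z M.commutator_in_iff[of a "commutator G (inv b) z"]
        by (simp del: mult_FactGroup)
      have inv: "inv\<^bsub>G Mod M\<^esub> (M #> g) = M #> inv g" if "g \<in> carrier G" for g
        using that by simp
      have "(M #> z) \<otimes>\<^bsub>G Mod M\<^esub> commutator (G Mod M) (M #> a) (M #> b) =
          commutator (G Mod M) (M #> a) (M #> b) \<otimes>\<^bsub>G Mod M\<^esub> (M #> z)"
      proof (rule q.H.commutator_commute)
        fix g assume "g \<in> carrier (G Mod M)"
        then show "commutator (G Mod M) (inv\<^bsub>G Mod M\<^esub> (M #> a)) (M #> z) \<otimes>\<^bsub>G Mod M\<^esub> g =
            g \<otimes>\<^bsub>G Mod M\<^esub> commutator (G Mod M) (inv\<^bsub>G Mod M\<^esub> (M #> a)) (M #> z)"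
          using a z c
          by (auto simp only: M.carrier_Mod inv M.rcos_commutator[symmetric] inv_closed)
      next
        show "commutator (G Mod M) (inv\<^bsub>G Mod M\<^esub> (M #> b)) (M #> z) \<otimes>\<^bsub>G Mod M\<^esub> (M #> a) =
            (M #> a) \<otimes>\<^bsub>G Mod M\<^esub> commutator (G Mod M) (inv\<^bsub>G Mod M\<^esub> (M #> b)) (M #> z)"
          using ab z e by (simp only: inv M.rcos_commutator[symmetric] inv_closed)
      qed (use a ab z in \<open>simp_all del: mult_FactGroup\<close>)
      then show ?thesis
        using a ab z by (simp only: M.commutator_in_iff M.rcos_commutator commutator_closed)
    qed
    moreover have "(\<Union>a\<in>lower_central G (Suc i). commutator G a ` carrier G) \<subseteq> carrier G"
      using lower_central_subset_carrier[of "Suc i"] commutator_closed by blast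
    ultimately have "commutator G z x \<in> M"
      using M.commutator_generate[OF z] Suc.prems(1) unfolding lower_central_Suc_Suc by blast
    then show ?thesis
      using M.commutator_in_sym[OF x z] j by (simp add: M_def)
  qed
qed

text \<open>The hypothesis says that \<open>G Mod H\<close> is nilpotent of class at most
  \<open>n\<close>. Each commutator with an element of \<open>G\<close> descends one level, so
  gamma_{i+1} lies in level n-i of the upper series modulo \<open>H\<close>.\<close>

lemma (in normal) lower_central_subset_if_upper_central:
  assumes "carrier G \<subseteq> upper_central_mod G H n"
  shows "lower_central G (Suc n) \<subseteq> H"
proof -
  have "lower_central G (Suc i) \<subseteq> upper_central_mod G H (n - i)" if "i \<le> n" for i
    using that
  proof (induction i)
    case (Suc i)
    have "n - i = Suc (n - Suc i)"
      using Suc.prems by simp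
    then have "lower_central G (Suc i) \<subseteq> center_mod G (upper_central_mod G H (n - Suc i))"
      using Suc by simp
    then show ?case
      unfolding lower_central_Suc_Suc
      by (intro generate_subgroup_incl normal_imp_subgroup[OF upper_central_mod_normal])
        (auto simp: center_mod_def)
  qed (use assms in simp)
  from this[of n] show ?thesis
    by simp
qed

text \<open>A nilpotency test by commutators in \<open>T\<close> alone. By induction on
  \<open>k\<close>, those of weight n-k+1 lie in level \<open>k\<close> modulo \<open>H\<close>: a
  further entry from \<open>T\<close> gives the previous case, an entry from \<open>N\<close> is
  controlled by \<open>commutator_lower_upper_central\<close>. At k = n both \<open>T\<close> and
  \<open>N\<close>, hence all of \<open>G\<close>, lie in level \<open>n\<close>.\<close>

lemma (in normal) lower_central_subset_if_left_normed:
  assumes T: "T \<subseteq> carrier G" "left_normed G T T n \<subseteq> H"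
    and N: "N \<subseteq> upper_central_mod G H n"
    and gen: "generate G (T \<union> N) = carrier G"
  shows "lower_central G (Suc n) \<subseteq> H"
proof -
  have U: "upper_central_mod G H k \<subseteq> carrier G" for k
    using upper_central_mod_normal[of k] normal_imp_subgroup subgroup.subset by blast
  have TN: "T \<union> N \<subseteq> carrier G"
    using T N U by blast
  have "left_normed G T T (n - k) \<subseteq> upper_central_mod G H k" if "k \<le> n" for k
    using that
  proof (induction k)
    case (Suc k)
    have k: "n - k = Suc (n - Suc k)"
      using Suc.prems by simp
    interpret M: normal "upper_central_mod G H k" G
      by (rule upper_central_mod_normal)
    show ?case
    proof
      fix x assume x: "x \<in> left_normed G T T (n - Suc k)"
      then have xl: "x \<in> lower_central G (Suc (n - Suc k))"
        using left_normed_subset_lower_central T by blast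
      have xc: "x \<in> carrier G"
        using xl lower_central_subset_carrier by blast
      have "commutator G x t \<in> upper_central_mod G H k" if "t \<in> T \<union> N" for t
      proof (cases "t \<in> T")
        case True
        then have "commutator G x t \<in> left_normed G T T (n - k)"
          using x k by auto
        then show ?thesis
          using Suc by auto
      next
        case False
        then have "t \<in> upper_central_mod G H n"
          using that N by auto
        \<comment> \<open>The resulting level is n - (n - k) = k.\<close>
        from commutator_lower_upper_central[OF xl this] show ?thesis
          using Suc.prems by (simp flip: k)
      qed
      then have "commutator G x y \<in> upper_central_mod G H k" if "y \<in> carrier G" for y
        using M.commutator_generate[OF xc TN] that gen by blast
      then show "x \<in> upper_central_mod G H (Suc k)"
        using xc by (simp add: center_mod_def)
    qed
  qed (use T in simp)
  from this[of n] have "T \<union> N \<subseteq> upper_central_mod G H n"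
    using N by simp
  then have "carrier G \<subseteq> upper_central_mod G H n"
    using generate_subgroup_incl[OF _ normal_imp_subgroup[OF upper_central_mod_normal]] gen by blast
  then show ?thesis
    by (rule lower_central_subset_if_upper_central)
qed

section \<open>Finitely generated and normal subgroups from generators\<close>

lemma (in group) finitely_generated_subgroup_iff:
  assumes "subgroup K G"
  shows "finitely_generated (G\<lparr>carrier := K\<rparr>) \<longleftrightarrow> (\<exists>S. finite S \<and> S \<subseteq> K \<and> generate G S = K)"
  using generate_consistent[OF _ assms] by (auto simp: finitely_generated_def)

text \<open>Conjugation by \<open>t\<close> is a homomorphism, so invariance passes from
  \<open>A\<close> to the subgroup it generates; products of elements of \<open>T\<close> give
  compositions. Closure of \<open>T\<close> under inverses matters because a conjugation may map a
  subgroup properly into itself.\<close>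

lemma (in group) generate_normalI:
  assumes A: "A \<subseteq> carrier G"
    and T: "generate G T = carrier G" "\<And>t. t \<in> T \<Longrightarrow> inv t \<in> T"
    and conj: "\<And>t a. t \<in> T \<Longrightarrow> a \<in> A \<Longrightarrow> t \<otimes> a \<otimes> inv t \<in> generate G A"
  shows "generate G A \<lhd> G"
proof -
  interpret K: subgroup "generate G A" G
    using A by (rule generate_is_subgroup)
  have Tc: "T \<subseteq> carrier G"
    using T(1) generate.incl by fastforce
  have t: "t \<otimes> k \<otimes> inv t \<in> generate G A" if t: "t \<in> T" and k: "k \<in> generate G A" for t k
    using k
  proof induction
    case one
    then show ?case
      using t Tc by (auto simp: subset_iff)
  next
    case (incl h)
    then show ?case
      using t conj by simp
  next
    case (inv h)
    then show ?case
      using t Tc A conj conj_inv[of t h] by (auto simp: subset_iff)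
  next
    case (eng h1 h2)
    then show ?case
      using t Tc conj_mult[of t h1 h2] by (auto simp: subset_iff)
  qed
  have g: "\<forall>k\<in>generate G A. g \<otimes> k \<otimes> inv g \<in> generate G A" if "g \<in> generate G T" for g
    using that
  proof induction
    case (eng h1 h2)
    show ?case
    proof
      fix k assume k: "k \<in> generate G A"
      have "h1 \<otimes> h2 \<otimes> k \<otimes> inv (h1 \<otimes> h2) = h1 \<otimes> (h2 \<otimes> k \<otimes> inv h2) \<otimes> inv h1"
        using eng.hyps k by (simp add: T m_assoc inv_mult_group)
      then show "h1 \<otimes> h2 \<otimes> k \<otimes> inv (h1 \<otimes> h2) \<in> generate G A"
        using eng.IH k by simp
    qed
  qed (use t T in auto)
  show ?thesis
    by (rule normal_invI) (use g T K.subgroup_axioms in auto)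
qed

section \<open>Lower central series under surjective homomorphisms\<close>

context group_hom
begin

lemma hom_commutator:
  "x \<in> carrier G \<Longrightarrow> y \<in> carrier G \<Longrightarrow> h (commutator G x y) = commutator H (h x) (h y)"
  by (simp add: commutator_def)

text \<open>Surjectivity enters at every step: the second entries of the commutators must range over
  all of \<open>carrier H\<close>.\<close>

lemma lower_central_image:
  assumes "h ` carrier G = carrier H"
  shows "h ` lower_central G n = lower_central H n"
proof (induction n rule: less_induct)
  case (less n)
  consider "n = 0" | "n = 1" | m where "n = Suc (Suc m)"
    by (metis One_nat_def not0_implies_Suc)
  then show ?case
  proof cases
    case 3
    let ?C = "\<Union>x\<in>lower_central G (Suc m). commutator G x ` carrier G"
    have L: "lower_central G (Suc m) \<subseteq> carrier G"
      by (rule G.lower_central_subset_carrier)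
    have "h ` ?C = (\<Union>x\<in>h ` lower_central G (Suc m). commutator H x ` h ` carrier G)"
      using L by (auto simp: image_UN image_image hom_commutator subset_iff)
    also have "\<dots> = (\<Union>x\<in>lower_central H (Suc m). commutator H x ` carrier H)"
      using less 3 assms by simp
    finally have C: "h ` ?C = \<dots>" .
    have "h ` generate G ?C = generate H (h ` ?C)"
      using L by (intro generate_img[symmetric]) auto
    then show ?thesis
      unfolding 3 lower_central_Suc_Suc C .
  qed (use assms in simp_all)
qed

lemma finitely_generated_lower_central_image:
  assumes "h ` carrier G = carrier H" "finitely_generated (G\<lparr>carrier := lower_central G n\<rparr>)"
  shows "finitely_generated (H\<lparr>carrier := lower_central H n\<rparr>)"
proof -
  obtain S where S: "finite S" "S \<subseteq> lower_central G n" "generate G S = lower_central G n"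
    using assms(2)
    by (auto simp: G.finitely_generated_subgroup_iff normal_imp_subgroup G.lower_central_normal)
  have "generate H (h ` S) = lower_central H n"
    using generate_img[of S] S G.lower_central_subset_carrier lower_central_image[OF assms(1)]
    by fastforce
  moreover have "h ` S \<subseteq> lower_central H n"
    using S(2) lower_central_image[OF assms(1)] by blast
  ultimately have "\<exists>S. finite S \<and> S \<subseteq> lower_central H n \<and> generate H S = lower_central H n"
    using S(1) by blast
  then show ?thesis
    by (simp add: H.finitely_generated_subgroup_iff normal_imp_subgroup H.lower_central_normal)
qed

text \<open>Any \<open>x\<close> has the same image as some \<open>g\<close> generated by
  \<open>T\<close>, and differs from it by the kernel element g^{-1} x.\<close>

lemma generate_Un_kernel:
  assumes "T \<subseteq> carrier G" "generate H (h ` T) = carrier H"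
  shows "generate G (T \<union> kernel G H h) = carrier G"
proof
  have "T \<union> kernel G H h \<subseteq> carrier G"
    using assms(1) by (auto simp: kernel_def)
  then show "generate G (T \<union> kernel G H h) \<subseteq> carrier G"
    by (rule G.generate_incl)
  show "carrier G \<subseteq> generate G (T \<union> kernel G H h)"
  proof
    fix x assume x: "x \<in> carrier G"
    then have "h x \<in> h ` generate G T"
      using assms generate_img by simp
    then obtain g where g: "g \<in> generate G T" "h x = h g"
      by auto
    have gc: "g \<in> carrier G"
      using g assms(1) G.generate_incl by blast
    have "inv g \<otimes> x \<in> kernel G H h"
      using x g gc by (simp add: kernel_def)
    moreover have "g \<in> generate G (T \<union> kernel G H h)"
      using g G.mono_generate[of T "T \<union> kernel G H h"] by blast
    ultimately have "g \<otimes> (inv g \<otimes> x) \<in> generate G (T \<union> kernel G H h)"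
      by (blast intro: generate.eng generate.incl)
    then show "x \<in> generate G (T \<union> kernel G H h)"
      using x gc by (simp add: G.inv_cancel_left)
  qed
qed

text \<open>This is (i) to (ii) with the letters of the locale: here \<open>G\<close> is the
  extension, \<open>H\<close> the quotient and \<open>h\<close> the projection.\<close>

lemma finitely_generated_lower_central_lift:
  assumes surj: "h ` carrier G = carrier H"
    and fg: "finitely_generated H" "finitely_generated (H\<lparr>carrier := lower_central H (Suc n)\<rparr>)"
    and ker: "kernel G H h \<subseteq> upper_central_mod G {\<one>} n"
  shows "finitely_generated (G\<lparr>carrier := lower_central G (Suc n)\<rparr>)"
proof -
  let ?N = "kernel G H h"
  define \<Gamma> where "\<Gamma> = lower_central G (Suc n)"
  interpret \<Gamma>: normal \<Gamma> G
    unfolding \<Gamma>_def by (rule G.lower_central_normal)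
  interpret I: normal "{\<one>}" G
    by (rule G.one_is_normal)
  have h\<Gamma>: "h ` \<Gamma> = lower_central H (Suc n)"
    unfolding \<Gamma>_def by (rule lower_central_image[OF surj])
  \<comment> \<open>With i = j = n the level n - (n+1) truncates to 0, the trivial subgroup.\<close>
  have \<Gamma>N: "commutator G g z = \<one>" if "g \<in> \<Gamma>" "z \<in> ?N" for g z
    using I.commutator_lower_upper_central[of g n z n] that ker by (auto simp: \<Gamma>_def)

  obtain S where S: "finite S" "S \<subseteq> carrier H" "generate H S = carrier H"
    using fg(1) by (auto simp: finitely_generated_def)
  obtain T0 where T0: "T0 \<subseteq> carrier G" "finite T0" "S = h ` T0"
    using S surj finite_subset_image by metis
  define T where "T = T0 \<union> m_inv G ` T0"
  have T: "finite T" "T \<subseteq> carrier G" "\<And>t. t \<in> T \<Longrightarrow> inv t \<in> T"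
    using T0 by (auto simp: T_def subset_iff)
  have "generate H (h ` T) = carrier H"
  proof
    show "generate H (h ` T) \<subseteq> carrier H"
      using T(2) by (intro H.generate_incl) auto
    show "carrier H \<subseteq> generate H (h ` T)"
      using H.mono_generate[of S "h ` T"] S T0 by (auto simp: T_def)
  qed
  then have gen: "generate G (T \<union> ?N) = carrier G"
    using T(2) generate_Un_kernel by blast

  obtain B where B: "finite B" "B \<subseteq> h ` \<Gamma>" "generate H B = h ` \<Gamma>"
    using fg(2) unfolding h\<Gamma>
    by (auto simp: H.finitely_generated_subgroup_iff normal_imp_subgroup H.lower_central_normal)
  obtain A0 where A0: "A0 \<subseteq> \<Gamma>" "finite A0" "B = h ` A0"
    using B finite_subset_image by metis
  define A where "A = A0 \<union> left_normed G T T n"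
  have A: "finite A" "A \<subseteq> \<Gamma>"
    using A0 T finite_left_normed G.left_normed_subset_lower_central by (auto simp: A_def \<Gamma>_def)
  have Ac: "A \<subseteq> carrier G"
    using A \<Gamma>.subset by auto
  have "h ` \<Gamma> \<subseteq> generate H (h ` A)"
    using H.mono_generate[of B "h ` A"] B A0 by (auto simp: A_def)
  then have hA: "h ` \<Gamma> \<subseteq> h ` generate G A"
    using generate_img[OF Ac] by simp

  \<comment> \<open>The conjugate has the same image as some \<open>k\<close> generated by
    \<open>A\<close>; the quotient of the two lies in the kernel, and in \<Gamma> since both
    do.\<close>
  have "\<exists>z. z \<in> \<Gamma> \<inter> ?N \<and> (\<exists>k\<in>generate G A. t \<otimes> a \<otimes> inv t = k \<otimes> z)"
    if "a \<in> A" "t \<in> T" for a t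
  proof -
    have \<Gamma>: "t \<otimes> a \<otimes> inv t \<in> \<Gamma>"
      using that A T \<Gamma>.inv_op_closed2 by blast
    then have "h (t \<otimes> a \<otimes> inv t) \<in> h ` generate G A"
      using hA by auto
    then obtain k where k: "k \<in> generate G A" "h (t \<otimes> a \<otimes> inv t) = h k"
      by auto
    define u where "u = t \<otimes> a \<otimes> inv t"
    have u: "u \<in> \<Gamma>" "h u = h k"
      using \<Gamma> k by (simp_all add: u_def)
    have k\<Gamma>: "k \<in> \<Gamma>"
      using k G.generate_subgroup_incl[OF A(2) \<Gamma>.subgroup_axioms] by auto
    have "inv k \<otimes> u \<in> \<Gamma> \<inter> ?N"
      using u k\<Gamma> by (simp add: kernel_def)
    moreover have "u = k \<otimes> (inv k \<otimes> u)"
      using u k\<Gamma> by (simp add: G.inv_cancel_left)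
    ultimately show ?thesis
      using k unfolding u_def[symmetric] by blast
  qed
  then obtain \<zeta> where \<zeta>: "\<And>a t. a \<in> A \<Longrightarrow> t \<in> T \<Longrightarrow> \<zeta> a t \<in> \<Gamma> \<inter> ?N"
    "\<And>a t. a \<in> A \<Longrightarrow> t \<in> T \<Longrightarrow> \<exists>k\<in>generate G A. t \<otimes> a \<otimes> inv t = k \<otimes> \<zeta> a t"
    by metis
  define Z where "Z = (\<Union>a\<in>A. \<zeta> a ` T)"
  \<comment> \<open>Closes \<open>Z\<close> under commutators with \<open>T\<close>. Stopping at
    \<open>n\<close> suffices: by \<open>W_left\<close> the entries for j = n are trivial.\<close>
  define W where "W = (\<Union>j\<le>n. left_normed G Z T j)"
  have Z: "finite Z" "Z \<subseteq> \<Gamma> \<inter> ?N"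
    using A(1) T(1) \<zeta>(1) by (auto simp: Z_def)
  have W_left: "left_normed G Z T j \<subseteq> \<Gamma> \<inter> upper_central_mod G {\<one>} (n - j)" if "j \<le> n" for j
    using that
  proof (induction j)
    case 0
    then show ?case
      using Z ker by auto
  next
    case (Suc j)
    have "n - j = Suc (n - Suc j)"
      using Suc.prems by simp
    then have "left_normed G Z T j \<subseteq> \<Gamma> \<inter> center_mod G (upper_central_mod G {\<one>} (n - Suc j))"
      using Suc by simp
    moreover have "commutator G z t \<in> \<Gamma> \<inter> upper_central_mod G {\<one>} (n - Suc j)"
      if "z \<in> \<Gamma> \<inter> center_mod G (upper_central_mod G {\<one>} (n - Suc j))" "t \<in> T" for z t
      using that T(2) \<Gamma>.commutator_in unfolding center_mod_def by blast
    ultimately show ?case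
      unfolding left_normed.simps by blast
  qed
  have W: "finite W" "W \<subseteq> \<Gamma>" "Z \<subseteq> W"
    using W_left Z(1) T(1) finite_left_normed by (auto simp: W_def intro!: bexI[of _ 0])
  define K where "K = generate G (A \<union> W)"
  have AWc: "A \<union> W \<subseteq> carrier G"
    using Ac W \<Gamma>.subset by auto
  interpret K: subgroup K G
    unfolding K_def using AWc by (rule G.generate_is_subgroup)
  have sub: "A \<union> W \<subseteq> K"
    unfolding K_def by (auto intro: generate.incl)
  have AK: "generate G A \<subseteq> K"
    unfolding K_def by (intro G.mono_generate) auto

  have "K \<lhd> G"
    unfolding K_def
  proof (rule G.generate_normalI[OF AWc gen])
    show "inv t \<in> T \<union> ?N" if "t \<in> T \<union> ?N" for t
      using that T(3) subgroup_kernel subgroup.m_inv_closed by fastforce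
  next
    fix t a assume t: "t \<in> T \<union> ?N" and a: "a \<in> A \<union> W"
    have tc: "t \<in> carrier G" and ac: "a \<in> carrier G"
      using t a T AWc by (auto simp: kernel_def)
    have "t \<otimes> a \<otimes> inv t \<in> K"
    proof (cases "t \<in> T")
      \<comment> \<open>For \<open>t\<close> in the kernel: it centralizes \<Gamma>, so
        \<open>a\<close> is fixed.\<close>
      case False
      then have "commutator G a t = \<one>"
        using t a A W \<Gamma>N by auto
      then have "a \<otimes> t = t \<otimes> a"
        using tc ac G.commutator_eq_one_iff by simp
      then have "t \<otimes> a \<otimes> inv t = a"
        using tc ac by (metis G.inv_closed G.m_assoc G.r_inv G.r_one)
      then show ?thesis
        using a sub by auto
    next
      case tT: True
      show ?thesis
      proof (cases "a \<in> A")
        case True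
        then obtain k where "k \<in> generate G A" "t \<otimes> a \<otimes> inv t = k \<otimes> \<zeta> a t"
          using \<zeta>(2) tT by blast
        moreover have "\<zeta> a t \<in> K"
          using True tT W(3) sub by (auto simp: Z_def)
        ultimately show ?thesis
          using AK by auto
      next
        case False
        then obtain j where j: "j \<le> n" "a \<in> left_normed G Z T j"
          using a by (auto simp: W_def)
        show ?thesis
        proof (cases "j = n")
          case True
          then have "a = \<one>"
            using W_left[of n] j by auto
          then show ?thesis
            using tc by simp
        next
          case False
          have "commutator G a t \<in> left_normed G Z T (Suc j)"
            using j tT by auto
          then have "commutator G a t \<in> W"
            using j False unfolding W_def by (intro UN_I[of "Suc j"]) auto
          \<comment> \<open>Conjugation by \<open>t\<close> alters \<open>a\<close> only by [a, t],
            the next iterated commutator, which is again in \<open>W\<close>.\<close>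
          moreover have "t \<otimes> a \<otimes> inv t = inv (commutator G a t) \<otimes> a"
            using tc ac by (simp add: commutator_def G.m_assoc G.inv_mult_group)
          ultimately show ?thesis
            using sub a by auto
        qed
      qed
    qed
    then show "t \<otimes> a \<otimes> inv t \<in> generate G (A \<union> W)"
      by (simp add: K_def)
  qed
  then interpret K: normal K G .
  \<comment> \<open>Replacing the trivial subgroup by \<open>K\<close> only enlarges the upper
    series, so the nilpotency test applies modulo \<open>K\<close>.\<close>
  have "?N \<subseteq> upper_central_mod G K n"
    using ker G.upper_central_mod_mono[of "{\<one>}" K n] by auto
  then have "\<Gamma> \<subseteq> K"
    unfolding \<Gamma>_def
    using T(2) gen sub by (intro K.lower_central_subset_if_left_normed[of T]) (auto simp: A_def)
  moreover have "K \<subseteq> \<Gamma>"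
    unfolding K_def using A W by (intro G.generate_subgroup_incl \<Gamma>.subgroup_axioms) auto
  ultimately have "generate G (A \<union> W) = \<Gamma>"
    by (simp add: K_def)
  then have "\<exists>S. finite S \<and> S \<subseteq> \<Gamma> \<and> generate G S = \<Gamma>"
    using A W by (intro exI[of _ "A \<union> W"]) auto
  then show ?thesis
    using G.finitely_generated_subgroup_iff[OF \<Gamma>.subgroup_axioms] by (simp add: \<Gamma>_def)
qed

end

section \<open>The equivalence\<close>

text \<open>Supplies the trivial extension on the required carrier type. The unspecified values of
  \<open>projl\<close> on \<open>Inr\<close> never matter, as the carrier consists of
  \<open>Inl\<close> elements.\<close>

lemma (in group) exists_iso_sum_type:
  "\<exists>(H :: ('a + 'c) monoid) \<pi>. group H \<and> \<pi> \<in> iso H G"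
proof -
  define H :: "('a + 'c) monoid"
    where "H = \<lparr>carrier = Inl ` carrier G, monoid.mult = \<lambda>x y. Inl (projl x \<otimes> projl y), one = Inl \<one>\<rparr>"
  have "group H"
    by (rule groupI) (auto simp: H_def m_assoc intro!: bexI[of _ "inv _"])
  moreover have "projl \<in> iso H G"
    by (auto simp: iso_def hom_def H_def bij_betw_def inj_on_def image_image)
  ultimately show ?thesis
    by blast
qed

theorem proposition3p4:
  fixes G :: "('a, 'm) monoid_scheme" and n :: nat
  assumes "group G" and "finitely_generated G"
  shows "finitely_generated (G\<lparr>carrier := lower_central G (n + 1)\<rparr>) \<longleftrightarrow>
    (\<forall>(H :: ('a + 'b) monoid) N \<pi>.
       group_extension N H G \<pi> \<longrightarrow> N \<subseteq> upper_central H n \<longrightarrow>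
       finitely_generated (H\<lparr>carrier := lower_central H (n + 1)\<rparr>))"
proof (intro iffI allI impI)
  fix H :: "('a + 'b) monoid" and N \<pi>
  assume fg: "finitely_generated (G\<lparr>carrier := lower_central G (n + 1)\<rparr>)"
    and ext: "group_extension N H G \<pi>" and N: "N \<subseteq> upper_central H n"
  \<comment> \<open>The extension \<open>H\<close> now plays the locale's \<open>G\<close>, so facts
    prefixed \<open>G.\<close> speak about \<open>H\<close>.\<close>
  interpret group_hom H G \<pi>
    using ext by (simp add: group_extension_def epi_def group_hom_def group_hom_axioms_def)
  show "finitely_generated (H\<lparr>carrier := lower_central H (n + 1)\<rparr>)"
    using finitely_generated_lower_central_lift[of n] fg assms ext N
    by (simp add: group_extension_def epi_def G.upper_central_eq)
next
  assume ii: "\<forall>(H :: ('a + 'b) monoid) N \<pi>.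
       group_extension N H G \<pi> \<longrightarrow> N \<subseteq> upper_central H n \<longrightarrow>
       finitely_generated (H\<lparr>carrier := lower_central H (n + 1)\<rparr>)"
  \<comment> \<open>Condition (ii) is used only for a copy of \<open>G\<close> with trivial kernel;
    the finite generating set is then carried back along \<pi>.\<close>
  obtain H :: "('a + 'b) monoid" and \<pi> where H: "group H" "\<pi> \<in> iso H G"
    using group.exists_iso_sum_type[OF assms(1)] by blast
  interpret group_hom H G \<pi>
    using H assms by (simp add: Group.iso_iff group_hom_def group_hom_axioms_def)
  have ker: "kernel H G \<pi> = {\<one>\<^bsub>H\<^esub>}" and surj: "\<pi> ` carrier H = carrier G"
    using H iso_kernel_image[OF H(1) assms(1)] by auto
  have "group_extension {\<one>\<^bsub>H\<^esub>} H G \<pi>"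
    using H assms ker surj homh G.triv_subgroup by (simp add: group_extension_def epi_def)
  moreover have "{\<one>\<^bsub>H\<^esub>} \<subseteq> upper_central H n"
    using normal_imp_subgroup[OF normal.upper_central_mod_normal[OF G.one_is_normal]]
      subgroup.one_closed by (fastforce simp: G.upper_central_eq)
  ultimately have "finitely_generated (H\<lparr>carrier := lower_central H (n + 1)\<rparr>)"
    using ii by blast
  then show "finitely_generated (G\<lparr>carrier := lower_central G (n + 1)\<rparr>)"
    using finitely_generated_lower_central_image[OF surj] by blast
qed

end
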